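(* Let $n\ge2$ be an integer of the form $n=4k$ or $n=4k+3$ with $k$ an integer. Then there is no non-trivial (i.e. not identically zero) $\mathrm{GL}_n^+(\mathbb R)$-invariant Poisson structure on the manifold $\mathcal S_n^{++}(\mathbb R)$ of real symmetric positive definite $n\times n$ matrices.
   Context: $\mathcal S_n^{++}(\mathbb R)$ is an open subset of the vector space of real symmetric $n\times n$ matrices. $\mathrm{GL}_n^+(\mathbb R)$ is the group of real $n\times n$ matrices with positive determinant, acting on $\mathcal S_n^{++}(\mathbb R)$ by $g\cdot x=gxg^T$. A Poisson structure is a skew-symmetric bivector field $\pi$ with vanishing Schouten–Nijenhuis bracket $[\pi,\pi]_S=0$; it is invariant if it is preserved by the action of every $g\in\mathrm{GL}_n^+(\mathbb R)$. *)

theory Defs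
  imports "HOL-Analysis.Analysis"
begin

section \<open>The vector space of real symmetric matrices\<close>

typedef ('n::finite) symmat = "{A :: real^'n^'n. transpose A = A}"
  morphisms mat_of Symmat
  by (rule exI[of _ 0]) (simp add: transpose_def vec_eq_iff)

setup_lifting type_definition_symmat

instantiation symmat :: (finite) real_vector
begin

lift_definition zero_symmat :: "'a symmat" is 0
  by (simp add: transpose_def vec_eq_iff)
lift_definition plus_symmat :: "'a symmat \<Rightarrow> 'a symmat \<Rightarrow> 'a symmat" is "(+)"
  by (simp add: transpose_def vec_eq_iff)
lift_definition minus_symmat :: "'a symmat \<Rightarrow> 'a symmat \<Rightarrow> 'a symmat" is "(-)"
  by (simp add: transpose_def vec_eq_iff)
lift_definition uminus_symmat :: "'a symmat \<Rightarrow> 'a symmat" is uminus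
  by (simp add: transpose_def vec_eq_iff)
lift_definition scaleR_symmat :: "real \<Rightarrow> 'a symmat \<Rightarrow> 'a symmat" is "(*\<^sub>R)"
  by (simp add: transpose_def vec_eq_iff)

instance
  by standard (transfer; simp add: algebra_simps)+

end

(* The Euclidean structure inherited from real^'n^'n only serves to provide the standard topology
   of a finite-dimensional real vector space. *)
instantiation symmat :: (finite) real_inner
begin

lift_definition inner_symmat :: "'a symmat \<Rightarrow> 'a symmat \<Rightarrow> real" is inner .
lift_definition norm_symmat :: "'a symmat \<Rightarrow> real" is norm .
lift_definition dist_symmat :: "'a symmat \<Rightarrow> 'a symmat \<Rightarrow> real" is dist .
definition sgn_symmat :: "'a symmat \<Rightarrow> 'a symmat" where
  "sgn_symmat x = x /\<^sub>R norm x"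
definition uniformity_symmat :: "('a symmat \<times> 'a symmat) filter" where
  "uniformity_symmat = (INF e\<in>{0<..}. principal {(x, y). dist x y < e})"
definition open_symmat :: "'a symmat set \<Rightarrow> bool" where
  "open_symmat U \<longleftrightarrow> (\<forall>x\<in>U. eventually (\<lambda>(x', y). x' = x \<longrightarrow> y \<in> U) uniformity)"

instance
proof
  fix x y z :: "'a symmat" and r :: real and U :: "'a symmat set"
  show "dist x y = norm (x - y)"
    by transfer (simp add: dist_norm)
  show "inner x y = inner y x"
    by transfer (simp add: inner_commute)
  show "inner (x + y) z = inner x z + inner y z"
    by transfer (simp add: inner_add_left)
  show "inner (r *\<^sub>R x) y = r * inner x y"
    by transfer simp
  show "0 \<le> inner x x"
    by transfer simp
  show "inner x x = 0 \<longleftrightarrow> x = 0"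
    by transfer simp
  show "norm x = sqrt (inner x x)"
    by transfer (simp add: norm_eq_sqrt_inner)
qed (fact sgn_symmat_def uniformity_symmat_def open_symmat_def)+

end

lemma ex_orthonormal_basis_symmat:
  "\<exists>B :: 'n::finite symmat set. B \<noteq> {} \<and> finite B \<and>
     (\<forall>u\<in>B. \<forall>v\<in>B. u \<bullet> v = (if u = v then 1 else 0)) \<and> (\<forall>x. (\<forall>u\<in>B. x \<bullet> u = 0) \<longleftrightarrow> x = 0)"
proof -
  let ?S = "{A :: real^'n^'n. transpose A = A}"
  have S: "subspace ?S"
    by (simp add: subspace_def transpose_def vec_eq_iff)
  obtain C where C: "C \<subseteq> ?S" "pairwise orthogonal C" "\<And>x. x \<in> C \<Longrightarrow> norm x = 1"
      "independent C" "card C = dim ?S" "span C = ?S"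
    by (rule orthonormal_basis_subspace[OF S]) blast
  have fin: "finite C"
    using C(4) by (rule independent_imp_finite)
  have one: "mat 1 \<in> ?S" "mat 1 \<noteq> (0 :: real^'n^'n)"
    by (simp_all add: transpose_mat) (simp add: mat_def vec_eq_iff)
  have ne: "C \<noteq> {}"
    using one C(6) by (metis singletonD span_empty)
  let ?B = "Symmat ` C"
  have rep: "mat_of (Symmat c) = c" if "c \<in> C" for c
    using that C(1) by (auto simp: Symmat_inverse)
  have orth: "\<forall>u\<in>?B. \<forall>v\<in>?B. u \<bullet> v = (if u = v then 1 else 0)"
  proof (intro ballI)
    fix u v assume "u \<in> ?B" "v \<in> ?B"
    then obtain c d where cd: "c \<in> C" "d \<in> C" "u = Symmat c" "v = Symmat d"
      by auto
    have "u \<bullet> v = c \<bullet> d"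
      using cd rep by (simp add: inner_symmat.rep_eq)
    moreover have "u = v \<longleftrightarrow> c = d"
      using cd rep by metis
    moreover have "c \<bullet> d = (if c = d then 1 else 0)"
      using C(2) C(3)[OF cd(1)] cd
      by (auto simp: pairwise_def orthogonal_def norm_eq_1)
    ultimately show "u \<bullet> v = (if u = v then 1 else 0)"
      by simp
  qed
  have zero: "(\<forall>u\<in>?B. x \<bullet> u = 0) \<longleftrightarrow> x = 0" for x
  proof
    assume *: "\<forall>u\<in>?B. x \<bullet> u = 0"
    have "orthogonal (mat_of x) c" if "c \<in> C" for c
      using * that rep by (auto simp: inner_symmat.rep_eq orthogonal_def)
    moreover have "mat_of x \<in> span C"
      using C(6) mat_of by auto
    ultimately have "orthogonal (mat_of x) (mat_of x)"
      using orthogonal_to_span by blast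
    then have "x \<bullet> x = 0"
      by (simp add: inner_symmat.rep_eq orthogonal_def)
    then show "x = 0"
      by simp
  qed simp
  show ?thesis
    by (rule exI[of _ ?B], intro conjI allI) (use ne fin in simp, use fin in simp, rule orth, rule zero)
qed

instantiation symmat :: (finite) euclidean_space
begin

definition Basis_symmat :: "'a symmat set" where
  "Basis_symmat = (SOME B. B \<noteq> {} \<and> finite B \<and>
     (\<forall>u\<in>B. \<forall>v\<in>B. u \<bullet> v = (if u = v then 1 else 0)) \<and> (\<forall>x. (\<forall>u\<in>B. x \<bullet> u = 0) \<longleftrightarrow> x = 0))"

instance
proof
  note * = someI_ex[OF ex_orthonormal_basis_symmat[where 'n = 'a], folded Basis_symmat_def]
  show "(Basis :: 'a symmat set) \<noteq> {}"
    by (rule *[THEN conjunct1])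
  show "finite (Basis :: 'a symmat set)"
    by (rule *[THEN conjunct2, THEN conjunct1])
  show "u \<bullet> v = (if u = v then 1 else 0)" if "u \<in> Basis" "v \<in> Basis" for u v :: "'a symmat"
    by (rule *[THEN conjunct2, THEN conjunct2, THEN conjunct1, rule_format, OF that])
  show "(\<forall>u\<in>Basis. x \<bullet> u = 0) \<longleftrightarrow> x = 0" for x :: "'a symmat"
    by (rule *[THEN conjunct2, THEN conjunct2, THEN conjunct2, rule_format])
qed

end

section \<open>Poisson structures on open subsets of a Euclidean space\<close>

primrec C_k_on :: "nat \<Rightarrow> 'a::euclidean_space set \<Rightarrow> ('a \<Rightarrow> 'b::real_normed_vector) \<Rightarrow> bool" where
  "C_k_on 0 U f \<longleftrightarrow> continuous_on U f"
| "C_k_on (Suc k) U f \<longleftrightarrow> (\<forall>x\<in>U. f differentiable (at x)) \<and>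
     (\<forall>v. C_k_on k U (\<lambda>x. frechet_derivative f (at x) v))"

definition smooth_on :: "'a::euclidean_space set \<Rightarrow> ('a \<Rightarrow> 'b::real_normed_vector) \<Rightarrow> bool" where
  "smooth_on U f \<longleftrightarrow> (\<forall>k. C_k_on k U f)"

(* A 2-tensor at a point is a bilinear form on covectors, with the convention
   (v \<and> w)(\<alpha>, \<beta>) = \<alpha>(v) \<beta>(w) - \<alpha>(w) \<beta>(v); skewness is imposed in bivector_field_on below.
   Values of a field outside its domain U are irrelevant. *)
type_synonym 'a tensor2 = "('a \<Rightarrow>\<^sub>L real) \<Rightarrow>\<^sub>L ('a \<Rightarrow>\<^sub>L real) \<Rightarrow>\<^sub>L real"

definition bivector_field_on :: "'a::euclidean_space set \<Rightarrow> ('a \<Rightarrow> 'a tensor2) \<Rightarrow> bool" where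
  "bivector_field_on U \<pi> \<longleftrightarrow> smooth_on U \<pi> \<and>
     (\<forall>x\<in>U. \<forall>\<alpha> \<beta>. blinfun_apply (\<pi> x \<alpha>) \<beta> = - blinfun_apply (\<pi> x \<beta>) \<alpha>)"

(* In the linear coordinates given by the basis, this is the standard formula
     [P,Q]^(ijk) = SUM l. P^(li) d_l Q^(jk) + Q^(li) d_l P^(jk) + cyclic permutations of (i,j,k),
   which comes from bilinearity and the rule (with Lie brackets of vector fields)
     [X1 \<and> X2, Y1 \<and> Y2] = SUM i j. (-1)^(i+j) [Xi,Yj] \<and> X_(3-i) \<and> Y_(3-j),
   up to a global sign that depends on the convention. Here blinfun_inner_left l is the dual basis
   covector of l, as the basis is orthonormal. The derivatives only depend on P and Q near x. *)
definition schouten_bracket ::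
  "('a::euclidean_space \<Rightarrow> 'a tensor2) \<Rightarrow> ('a \<Rightarrow> 'a tensor2) \<Rightarrow> 'a \<Rightarrow>
     ('a \<Rightarrow>\<^sub>L real) \<Rightarrow> ('a \<Rightarrow>\<^sub>L real) \<Rightarrow> ('a \<Rightarrow>\<^sub>L real) \<Rightarrow> real" where
  "schouten_bracket P Q x \<alpha> \<beta> \<gamma> =
    (let T = (\<lambda>\<alpha> \<beta> \<gamma>. \<Sum>l\<in>Basis.
           P x (blinfun_inner_left l) \<alpha> * frechet_derivative Q (at x) l \<beta> \<gamma>
         + Q x (blinfun_inner_left l) \<alpha> * frechet_derivative P (at x) l \<beta> \<gamma>)
     in T \<alpha> \<beta> \<gamma> + T \<beta> \<gamma> \<alpha> + T \<gamma> \<alpha> \<beta>)"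

definition poisson_structure_on :: "'a::euclidean_space set \<Rightarrow> ('a \<Rightarrow> 'a tensor2) \<Rightarrow> bool" where
  "poisson_structure_on U \<pi> \<longleftrightarrow> bivector_field_on U \<pi> \<and>
     (\<forall>x\<in>U. \<forall>\<alpha> \<beta> \<gamma>. schouten_bracket \<pi> \<pi> x \<alpha> \<beta> \<gamma> = 0)"

(* Preserved by a diffeomorphism \<phi> of U: the push-forward of \<pi> x along the differential of \<phi> at x
   is \<pi> (\<phi> x). *)
definition preserves_tensor2_on ::
  "'a::euclidean_space set \<Rightarrow> ('a \<Rightarrow> 'a) \<Rightarrow> ('a \<Rightarrow> 'a tensor2) \<Rightarrow> bool" where
  "preserves_tensor2_on U \<phi> \<pi> \<longleftrightarrow> (\<forall>x\<in>U. \<forall>\<alpha> \<beta>.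
     (let d\<phi> = Blinfun (frechet_derivative \<phi> (at x))
      in \<pi> (\<phi> x) \<alpha> \<beta> = \<pi> x (\<alpha> o\<^sub>L d\<phi>) (\<beta> o\<^sub>L d\<phi>)))"

section \<open>Positive definite matrices and the congruence action\<close>

definition posdef :: "'n::finite symmat set" where
  "posdef = {x. \<forall>v. v \<noteq> 0 \<longrightarrow> v \<bullet> (mat_of x *v v) > 0}"

definition GL_pos :: "(real^'n^'n) set" where
  "GL_pos = {g. det g > 0}"

lift_definition congr_act :: "real^'n^'n \<Rightarrow> 'n::finite symmat \<Rightarrow> 'n symmat" is
  "\<lambda>g x. g ** x ** transpose g"
  by (simp add: matrix_transpose_mul matrix_mul_assoc)

definition GL_pos_invariant :: "('n::finite symmat \<Rightarrow> 'n symmat tensor2) \<Rightarrow> bool" where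
  "GL_pos_invariant \<pi> \<longleftrightarrow> (\<forall>g\<in>GL_pos. preserves_tensor2_on posdef (congr_act g) \<pi>)"

lemma congr_act_posdef:
  assumes "g \<in> GL_pos" "x \<in> posdef"
  shows "congr_act g x \<in> posdef"
proof -
  have inv: "invertible (transpose g)"
    using assms(1) by (simp add: GL_pos_def invertible_det_nz)
  have "v \<bullet> (mat_of (congr_act g x) *v v) > 0" if "v \<noteq> 0" for v
  proof -
    have "transpose g *v v \<noteq> 0"
      using inv that by (metis matrix_left_invertible_ker invertible_left_inverse)
    then have "(transpose g *v v) \<bullet> (mat_of x *v (transpose g *v v)) > 0"
      using assms(2) by (simp add: posdef_def)
    also have "(transpose g *v v) \<bullet> (mat_of x *v (transpose g *v v)) =
        v \<bullet> (mat_of (congr_act g x) *v v)"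
      by (simp add: congr_act.rep_eq dot_lmul_matrix flip: matrix_vector_mul_assoc)
    finally show ?thesis .
  qed
  then show ?thesis
    by (simp add: posdef_def)
qed

lemma bounded_linear_congr_act:
  fixes g :: "real^'n^'n"
  shows "bounded_linear (congr_act g)"
proof -
  have add: "(A + B) ** C = A ** C + B ** C" for A B C :: "real^'n^'n"
    by (simp add: matrix_matrix_mult_def vec_eq_iff sum.distrib distrib_right)
  have "linear (congr_act g)"
  proof (rule linearI)
    show "congr_act g (x + y) = congr_act g x + congr_act g y" for x y
      by transfer (simp only: matrix_add_ldistrib add)
    show "congr_act g (r *\<^sub>R x) = r *\<^sub>R congr_act g x" for r x
      by transfer (simp only: matrix_scalar_ac scalar_matrix_assoc)
  qed
  then show ?thesis
    by (simp add: linear_conv_bounded_linear)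
qed

lemma open_posdef: "open (posdef :: 'n::finite symmat set)"
  unfolding open_contains_ball
proof
  fix x :: "'n symmat" assume x: "x \<in> posdef"
  let ?q = "\<lambda>v. v \<bullet> (mat_of x *v v)"
  have "compact (sphere (0 :: real^'n) 1)" "sphere (0 :: real^'n) 1 \<noteq> {}"
    by auto
  moreover have "continuous_on (sphere 0 1) ?q"
    by (intro continuous_on_inner continuous_on_id matrix_vector_mult_linear_continuous_on)
  ultimately obtain u where u: "norm u = 1" "\<And>v. norm v = 1 \<Longrightarrow> ?q u \<le> ?q v"
    using continuous_attains_inf[of "sphere 0 1" ?q] by (auto simp: dist_norm)
  have "u \<noteq> 0"
    using u(1) by auto
  then have pos: "?q u > 0"
    using x unfolding posdef_def by blast
  let ?e = "?q u / (2 * real CARD('n))"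
  have bound: "\<bar>v \<bullet> (A *v v)\<bar> \<le> real CARD('n) * norm A" if "norm v = 1" for A :: "real^'n^'n" and v
  proof -
    have "\<bar>v \<bullet> (A *v v)\<bar> \<le> norm (A *v v)"
      using Cauchy_Schwarz_ineq2[of v "A *v v"] that by simp
    also have "\<dots> \<le> (\<Sum>i\<in>UNIV. \<bar>(A *v v) $ i\<bar>)"
      by (rule norm_le_l1_cart)
    also have "\<dots> \<le> (\<Sum>i\<in>(UNIV :: 'n set). norm A)"
    proof (rule sum_mono)
      fix i
      have "\<bar>(A *v v) $ i\<bar> = \<bar>A $ i \<bullet> v\<bar>"
        by (simp add: matrix_vector_mul_component)
      also have "\<dots> \<le> norm (A $ i)"
        using Cauchy_Schwarz_ineq2[of "A $ i" v] that by simp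
      also have "\<dots> \<le> norm A"
        by (rule Finite_Cartesian_Product.norm_nth_le)
      finally show "\<bar>(A *v v) $ i\<bar> \<le> norm A" .
    qed
    finally show ?thesis
      by simp
  qed
  have "y \<in> posdef" if y: "dist x y < ?e" for y
  proof -
    have unit: "w \<bullet> (mat_of y *v w) > 0" if w: "norm w = 1" for w
    proof -
      have "norm (mat_of x - mat_of y) < ?e"
        using y by (simp add: dist_symmat.rep_eq dist_norm)
      then have "real CARD('n) * norm (mat_of x - mat_of y) < ?q u"
        using pos by (simp add: field_simps)
      moreover have "w \<bullet> ((mat_of x - mat_of y) *v w) = ?q w - w \<bullet> (mat_of y *v w)"
        by (simp add: matrix_vector_mult_diff_rdistrib inner_diff_right)
      ultimately show ?thesis
        using bound[OF w, of "mat_of x - mat_of y"] u(2)[OF w] by linarith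
    qed
    have "v \<bullet> (mat_of y *v v) > 0" if "v \<noteq> 0" for v
    proof -
      have "0 < (v /\<^sub>R norm v) \<bullet> (mat_of y *v (v /\<^sub>R norm v))"
        using that by (intro unit) simp
      also have "\<dots> = (v \<bullet> (mat_of y *v v)) / (norm v)\<^sup>2"
        by (simp add: matrix_vector_mult_scaleR power2_eq_square divide_inverse)
      finally show ?thesis
        using that by (simp add: zero_less_divide_iff)
    qed
    then show ?thesis
      by (simp add: posdef_def)
  qed
  then have "ball x ?e \<subseteq> posdef"
    by auto
  moreover have "?e > 0"
    using pos by simp
  ultimately show "\<exists>e>0. ball x e \<subseteq> posdef"
    by blast
qed

end

theory Submission
  imports Defs
begin

text \<open>
  For \<open>n \<ge> 3\<close> there is not even a nonzero invariant bivector field, and the two residue classes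
  modulo \<open>4\<close> leave out \<open>n = 2\<close>.

  Fix a positive definite \<open>x\<close>, and regard it as an inner product \<open>x(u, v) = u\<^sup>T x v\<close>. The covectors
  \<open>X \<mapsto> u\<^sup>T X u\<close> span the dual of the space of symmetric matrices (polarization), so the value of
  the bivector field at \<open>x\<close> is determined by the numbers
  \<open>f(u, v) = \<pi>\<^sub>x(X \<mapsto> u\<^sup>T X u, X \<mapsto> v\<^sup>T X v)\<close>. Invariance under the stabilizer of \<open>x\<close> says that
  \<open>f(h u, h v) = f(u, v)\<close> for every \<open>h\<close> of positive determinant that is an isometry of \<open>x\<close>.
  If \<open>u\<close> and \<open>v\<close> have the same length, then the reflection along \<open>u - v\<close> swaps them; as \<open>n \<ge> 3\<close>,
  it can be composed with the reflection along a vector orthogonal to both, which gives a rotation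
  that still swaps them. Hence \<open>f(u, v) = f(v, u)\<close>, and skewness gives \<open>f(u, v) = 0\<close>. The case
  of different lengths follows because \<open>f\<close> is homogeneous of degree \<open>2\<close> in each argument.
\<close>

lemma transpose_mult_mult_eqI:
  fixes A h :: "real^'n^'n"
  assumes "\<And>y z. (h *v y) \<bullet> (A *v (h *v z)) = y \<bullet> (A *v z)"
  shows "transpose h ** A ** h = A"
proof -
  have "y \<bullet> (transpose h *v t) = (h *v y) \<bullet> t" for y t
    using dot_lmul_matrix[of t h y] by (simp add: inner_commute)
  then have "y \<bullet> ((transpose h ** A ** h) *v z) = y \<bullet> (A *v z)" for y z
    using assms[of y z] by (simp flip: matrix_vector_mul_assoc)
  then have "(transpose h ** A ** h) *v z = A *v z" for z
    using vector_eq_ldot by blast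
  then show ?thesis
    by (simp add: matrix_eq)
qed

text \<open>
  The half turn in the plane of two vectors \<open>a\<close> and \<open>w\<close>, orthonormal with respect to \<open>A\<close>, is the
  composition of the reflections along them. It is an involution and the square of a quarter turn,
  so its determinant is a nonzero square.
\<close>

lemma ex_half_turn:
  fixes A :: "real^'n^'n"
  assumes sym: "\<And>y z. y \<bullet> (A *v z) = z \<bullet> (A *v y)"
    and aa: "a \<bullet> (A *v a) = 1" and ww: "w \<bullet> (A *v w) = 1" and aw: "a \<bullet> (A *v w) = 0"
  obtains h :: "real^'n^'n" where "det h > 0" "transpose h ** A ** h = A"
    "\<And>y. h *v y = y - (2 * (a \<bullet> (A *v y))) *\<^sub>R a - (2 * (w \<bullet> (A *v y))) *\<^sub>R w"
proof -
  define p where "p y = a \<bullet> (A *v y)" for y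
  define r where "r y = w \<bullet> (A *v y)" for y
  have lin: "p (y + z) = p y + p z" "r (y + z) = r y + r z"
    "p (y - z) = p y - p z" "r (y - z) = r y - r z"
    "p (c *\<^sub>R y) = c * p y" "r (c *\<^sub>R y) = c * r y" for y z c
    by (simp_all add: p_def r_def matrix_vector_right_distrib matrix_vector_mult_diff_distrib
        inner_diff_right inner_add_right matrix_vector_mult_scaleR)
  have vals: "p a = 1" "r w = 1" "p w = 0" "r a = 0"
    using aa ww aw sym[of w a] by (simp_all add: p_def r_def)
  \<comment> \<open>the quarter turn \<open>a \<mapsto> w \<mapsto> -a\<close>\<close>
  define k where "k y = y - (p y + r y) *\<^sub>R a + (p y - r y) *\<^sub>R w" for y
  define h where "h y = y - (2 * p y) *\<^sub>R a - (2 * r y) *\<^sub>R w" for y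
  have lin_k: "linear k"
    by (rule linearI) (simp_all add: k_def lin algebra_simps)
  have lin_h: "linear h"
    by (rule linearI) (simp_all add: h_def lin algebra_simps)
  have kk: "k \<circ> k = h"
    by (simp add: fun_eq_iff k_def h_def lin vals vec_eq_iff algebra_simps)
  have hh: "h \<circ> h = id"
    by (simp add: fun_eq_iff h_def lin vals vec_eq_iff algebra_simps)
  have "det (matrix h) = det (matrix k) * det (matrix k)"
    using matrix_compose[OF lin_k lin_k] by (simp add: kk det_mul)
  moreover have "det (matrix h) * det (matrix h) = 1"
    using matrix_compose[OF lin_h lin_h] by (metis det_I det_mul hh matrix_id_mat_1)
  ultimately have det: "det (matrix h) > 0"
    by (metis mult_eq_0_iff zero_neq_one not_real_square_gt_zero)
  have app: "matrix h *v y = h y" for y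
    by (simp add: matrix_works lin_h)
  have "h y \<bullet> (A *v h z) = y \<bullet> (A *v z)" for y z
  proof -
    have "y \<bullet> (A *v a) = p y" "y \<bullet> (A *v w) = r y"
      using sym by (simp_all add: p_def r_def)
    moreover have "a \<bullet> (A *v h z) = - p z" "w \<bullet> (A *v h z) = - r z"
      using lin vals by (simp_all add: h_def flip: p_def r_def)
    moreover have "y \<bullet> (A *v h z) = y \<bullet> (A *v z) - 2 * p z * (y \<bullet> (A *v a)) - 2 * r z * (y \<bullet> (A *v w))"
      by (simp add: h_def matrix_vector_mult_diff_distrib inner_diff_right matrix_vector_mult_scaleR)
    ultimately show ?thesis
      by (simp add: h_def[of y] inner_diff_left)
  qed
  then have "transpose (matrix h) ** A ** matrix h = A"
    by (intro transpose_mult_mult_eqI) (simp add: app)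
  then show ?thesis
    using that det app by (simp add: h_def p_def r_def)
qed

text \<open>
  The rotation is the half turn in the plane of \<open>u - v\<close> and a vector orthogonal to \<open>u\<close> and \<open>v\<close>.
  In dimension \<open>2\<close> the only isometry that swaps two independent vectors is a reflection.
\<close>

lemma ex_rotation_swap:
  fixes A :: "real^'n^'n"
  assumes n: "CARD('n) \<ge> 3"
    and sym: "\<And>y z. y \<bullet> (A *v z) = z \<bullet> (A *v y)"
    and pos: "\<And>y. y \<noteq> 0 \<Longrightarrow> y \<bullet> (A *v y) > 0"
    and len: "u \<bullet> (A *v u) = v \<bullet> (A *v v)"
  obtains h :: "real^'n^'n" where "det h > 0" "transpose h ** A ** h = A" "h *v u = v" "h *v v = u"
proof (cases "u = v")
  case True
  then show ?thesis
    using that[of "mat 1"] by (simp add: transpose_mat)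
next
  case False
  have unit: "(y /\<^sub>R s) \<bullet> (A *v (y /\<^sub>R s)) = 1"
    if "s = sqrt (y \<bullet> (A *v y))" "y \<noteq> 0" for y s
    using pos[of y] that by (simp add: matrix_vector_mult_scaleR field_simps)
  have "dim {A *v u, A *v v} \<le> card {A *v u, A *v v}"
    by (rule dim_le_card') simp
  also have "\<dots> \<le> 2"
    by (simp add: card_insert_if)
  finally have "dim {A *v u, A *v v} < DIM(real^'n)"
    using n by simp
  then obtain w where w: "w \<noteq> 0" "\<And>y. y \<in> span {A *v u, A *v v} \<Longrightarrow> orthogonal w y"
    using orthogonal_to_subspace_exists[of "{A *v u, A *v v}"] by metis
  have wu: "w \<bullet> (A *v u) = 0" "w \<bullet> (A *v v) = 0"
    using w(2) by (simp_all add: span_base orthogonal_def)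
  define d where "d = u - v"
  define s where "s = sqrt (d \<bullet> (A *v d))"
  define t where "t = sqrt (w \<bullet> (A *v w))"
  have d: "d \<noteq> 0" "d \<bullet> (A *v d) > 0"
    using False pos by (simp_all add: d_def)
  have s: "s > 0" "s\<^sup>2 = d \<bullet> (A *v d)"
    using d by (simp_all add: s_def)
  have dw: "d \<bullet> (A *v w) = 0"
    using wu sym[of d w] by (simp add: d_def matrix_vector_mult_diff_distrib inner_diff_right)
  obtain h where h: "det h > 0" "transpose h ** A ** h = A"
    "\<And>y. h *v y = y - (2 * ((d /\<^sub>R s) \<bullet> (A *v y))) *\<^sub>R (d /\<^sub>R s)
                     - (2 * ((w /\<^sub>R t) \<bullet> (A *v y))) *\<^sub>R (w /\<^sub>R t)"
    using ex_half_turn[OF sym unit[OF s_def d(1)] unit[OF t_def w(1)]] dw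
    by (auto simp: matrix_vector_mult_scaleR)
  have hy: "h *v y = y - (2 * (d \<bullet> (A *v y)) / s\<^sup>2) *\<^sub>R d" if "w \<bullet> (A *v y) = 0" for y
    using that by (simp add: h(3) power2_eq_square field_simps)
  \<comment> \<open>The vectors \<open>u\<close> and \<open>v\<close> have equal lengths, so the component of each along \<open>u - v\<close> is half of
    it, up to sign.\<close>
  have "2 * (d \<bullet> (A *v u)) = s\<^sup>2" "2 * (d \<bullet> (A *v v)) = - s\<^sup>2"
    using len sym[of u v]
    by (simp_all add: s(2)) (simp_all add: d_def matrix_vector_mult_diff_distrib inner_diff_right inner_diff_left)
  then have "h *v u = v" "h *v v = u"
    using s(1) hy[OF wu(1)] hy[OF wu(2)] by (simp_all add: d_def)
  then show ?thesis
    using that h(1,2) by blast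
qed

lift_definition quad_covector :: "real^'n \<Rightarrow> 'n::finite symmat \<Rightarrow>\<^sub>L real" is
  "\<lambda>u X. u \<bullet> (mat_of X *v u)"
proof -
  fix u :: "real^'n"
  have "linear (\<lambda>X :: 'n symmat. u \<bullet> (mat_of X *v u))"
    by (rule linearI) (simp_all add: plus_symmat.rep_eq scaleR_symmat.rep_eq
        matrix_vector_mult_add_rdistrib inner_add_right flip: scaleR_matrix_vector_assoc)
  then show "bounded_linear (\<lambda>X :: 'n symmat. u \<bullet> (mat_of X *v u))"
    by (simp add: linear_conv_bounded_linear)
qed

lemma quad_covector_scaleR: "quad_covector (c *\<^sub>R u) = c\<^sup>2 *\<^sub>R quad_covector u"
  by (rule blinfun_eqI)
    (simp add: quad_covector.rep_eq matrix_vector_mult_scaleR scaleR_blinfun.rep_eq power2_eq_square)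

lemma quad_covector_congr_act:
  "quad_covector u o\<^sub>L Blinfun (congr_act g) = quad_covector (transpose g *v u)"
  by (rule blinfun_eqI)
    (simp add: quad_covector.rep_eq bounded_linear_Blinfun_apply bounded_linear_congr_act
      congr_act.rep_eq dot_lmul_matrix flip: matrix_vector_mul_assoc)

text \<open>Polarization expresses the matrix entries, and hence all covectors, by quadratic forms.\<close>

lemma span_quad_covector: "span (range quad_covector) = (UNIV :: ('n::finite symmat \<Rightarrow>\<^sub>L real) set)"
proof -
  let ?e = "\<lambda>i::'n. axis i (1::real)"
  let ?E = "\<lambda>i j. quad_covector (?e i + ?e j) - quad_covector (?e i) - quad_covector (?e j)"
  have "\<alpha> \<in> span (range quad_covector)" for \<alpha> :: "'n symmat \<Rightarrow>\<^sub>L real"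
  proof -
    have E: "?E i j X = 2 * mat_of X $ i $ j" for i j and X :: "'n symmat"
    proof -
      have "mat_of X $ j $ i = mat_of X $ i $ j"
        using mat_of[of X] by (simp add: transpose_def vec_eq_iff)
      then show ?thesis
        by (simp add: quad_covector.rep_eq minus_blinfun.rep_eq matrix_vector_right_distrib
            inner_add_left inner_add_right inner_axis' matrix_vector_mul_component inner_axis)
    qed
    have "\<alpha> = (\<Sum>b\<in>Basis. \<Sum>i\<in>UNIV. \<Sum>j\<in>UNIV. (\<alpha> b * mat_of b $ i $ j / 2) *\<^sub>R ?E i j)"
    proof (rule blinfun_eqI)
      fix X
      have "\<alpha> X = \<alpha> (\<Sum>b\<in>Basis. (X \<bullet> b) *\<^sub>R b)"
        by (simp add: euclidean_representation)
      also have "\<dots> = (\<Sum>b\<in>Basis. (X \<bullet> b) * \<alpha> b)"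
        by (simp add: blinfun.sum_right blinfun.scaleR_right)
      also have "\<dots> = (\<Sum>b\<in>Basis. \<Sum>i\<in>UNIV. \<Sum>j\<in>UNIV. (\<alpha> b * mat_of b $ i $ j / 2) * ?E i j X)"
        unfolding E by (simp add: inner_symmat.rep_eq inner_vec_def sum_distrib_left sum_distrib_right mult_ac)
      finally show "\<alpha> X = (\<Sum>b\<in>Basis. \<Sum>i\<in>UNIV. \<Sum>j\<in>UNIV. (\<alpha> b * mat_of b $ i $ j / 2) *\<^sub>R ?E i j) X"
        by (simp add: blinfun.sum_left blinfun.scaleR_left)
    qed
    also have "\<dots> \<in> span (range quad_covector)"
      by (intro span_sum span_scale span_diff span_base rangeI)
    finally show ?thesis .
  qed
  then show ?thesis
    by blast
qed

lemma tensor2_eq_0I: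
  fixes P :: "'n::finite symmat tensor2"
  assumes "\<And>u v. P (quad_covector u) (quad_covector v) = 0"
  shows "P = 0"
proof -
  have 1: "P (quad_covector u) \<beta> = 0" for u \<beta>
    by (rule span_induct[of \<beta> "range quad_covector"])
      (auto simp: span_quad_covector assms subspace_def blinfun.add_right blinfun.scaleR_right)
  have "P \<alpha> = 0" for \<alpha>
    by (rule span_induct[of \<alpha> "range quad_covector"])
      (auto simp: span_quad_covector 1 subspace_def blinfun.add_right blinfun.scaleR_right
        intro: blinfun_eqI)
  then show ?thesis
    by (auto intro: blinfun_eqI)
qed

lemma GL_pos_invariant_stabilizer:
  fixes \<pi> :: "'n::finite symmat \<Rightarrow> 'n symmat tensor2"
  assumes inv: "GL_pos_invariant \<pi>" and x: "x \<in> posdef"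
    and h: "det h > 0" "transpose h ** mat_of x ** h = mat_of x"
  shows "\<pi> x (quad_covector (h *v u)) (quad_covector (h *v v)) = \<pi> x (quad_covector u) (quad_covector v)"
proof -
  let ?g = "transpose h"
  have "congr_act ?g x = x"
    using h(2) by (metis congr_act.rep_eq mat_of_inject transpose_transpose)
  moreover have "frechet_derivative (congr_act ?g) (at x) = congr_act ?g"
    by (metis bounded_linear_congr_act bounded_linear_imp_has_derivative frechet_derivative_at)
  moreover have "preserves_tensor2_on posdef (congr_act ?g) \<pi>"
    using inv h(1) by (simp add: GL_pos_invariant_def GL_pos_def)
  ultimately show ?thesis
    using x unfolding preserves_tensor2_on_def Let_def
    by (metis quad_covector_congr_act transpose_transpose)
qed

theorem invariant_bivector_field_eq_0:
  fixes \<pi> :: "'n::finite symmat \<Rightarrow> 'n symmat tensor2"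
  assumes n: "CARD('n) \<ge> 3"
    and biv: "bivector_field_on posdef \<pi>" and inv: "GL_pos_invariant \<pi>" and x: "x \<in> posdef"
  shows "\<pi> x = 0"
proof (rule tensor2_eq_0I)
  let ?A = "mat_of x"
  let ?f = "\<lambda>u v. \<pi> x (quad_covector u) (quad_covector v)"
  have skew: "?f u v = - ?f v u" for u v
    using biv x unfolding bivector_field_on_def by blast
  have sym: "y \<bullet> (?A *v z) = z \<bullet> (?A *v y)" for y z
  proof -
    have "y v* ?A = ?A *v y"
      using mat_of[of x] transpose_matrix_vector[of ?A y] by simp
    then show ?thesis
      using dot_lmul_matrix[of y ?A z] by (simp add: inner_commute)
  qed
  have pos: "y \<bullet> (?A *v y) > 0" if "y \<noteq> 0" for y
    using x that by (simp add: posdef_def)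
  have scale: "?f (c *\<^sub>R u) (d *\<^sub>R v) = c\<^sup>2 * d\<^sup>2 * ?f u v" for c d u v
    by (simp add: quad_covector_scaleR blinfun.scaleR_left blinfun.scaleR_right)
  have eq_len: "?f u v = 0" if len: "u \<bullet> (?A *v u) = v \<bullet> (?A *v v)" for u v
  proof -
    obtain h where "det h > 0" "transpose h ** ?A ** h = ?A" "h *v u = v" "h *v v = u"
      using ex_rotation_swap[OF n sym pos len] by blast
    then have "?f v u = ?f u v"
      using GL_pos_invariant_stabilizer[OF inv x, of h u v] by simp
    then show ?thesis
      using skew[of u v] by simp
  qed
  show "?f u v = 0" for u v
  proof (cases "u = 0 \<or> v = 0")
    case True
    then show ?thesis
      using scale[of 0 u 1 v] scale[of 1 u 0 v] by auto
  next
    case False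
    define c where "c = sqrt (v \<bullet> (?A *v v))"
    define d where "d = sqrt (u \<bullet> (?A *v u))"
    have c: "c > 0" "c\<^sup>2 = v \<bullet> (?A *v v)" and d: "d > 0" "d\<^sup>2 = u \<bullet> (?A *v u)"
      using False pos[of u] pos[of v] by (simp_all add: c_def d_def)
    have "?f (c *\<^sub>R u) (d *\<^sub>R v) = 0"
      by (rule eq_len) (simp add: matrix_vector_mult_scaleR flip: c(2) d(2), simp add: power2_eq_square)
    then show ?thesis
      using c(1) d(1) by (simp add: scale)
  qed
qed

theorem theorem3p18:
  assumes "CARD('n::finite) \<ge> 2"
    and "\<exists>k::int. int CARD('n) = 4 * k \<or> int CARD('n) = 4 * k + 3"
  shows "\<not> (\<exists>\<pi> :: 'n symmat \<Rightarrow> 'n symmat tensor2.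
      poisson_structure_on posdef \<pi> \<and> GL_pos_invariant \<pi> \<and> (\<exists>x\<in>posdef. \<pi> x \<noteq> 0))"
proof -
  have "CARD('n) \<noteq> 2"
    using assms(2) by presburger
  then have "CARD('n) \<ge> 3"
    using assms(1) by linarith
  then show ?thesis
    using invariant_bivector_field_eq_0 by (auto simp: poisson_structure_on_def)
qed

end
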